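(* Let $\Phi_\kappa,Q,S\in\mathbb R^{n\times n}$ be symmetric matrices and $\rho>0$, where $\Phi_\kappa\succeq0$, $Q\succeq0$ and $S=\bar V\bar V^T$ for a real matrix $\bar V$ with $n$ rows. Define the fourth-order tensor $\mathcal F\in\mathbb R^{n\times n\times n\times n}$ by $$\mathcal F_{i,j,k,l}=\Phi_{\kappa[i,j]}\Phi_{\kappa[k,l]}+\rho\,Q_{i,j}S_{k,l},\qquad i,j,k,l=1,\dots,n,$$ the tensor $\mathcal F^s$ by $$\mathcal F^s_{i,j,k,l}=\tfrac13\big(\Phi_{\kappa[i,j]}\Phi_{\kappa[k,l]}+\Phi_{\kappa[i,k]}\Phi_{\kappa[j,l]}+\Phi_{\kappa[i,l]}\Phi_{\kappa[j,k]}\big)+\tfrac16\rho\big(Q_{i,j}S_{k,l}+Q_{i,k}S_{j,l}+Q_{i,l}S_{j,k}+Q_{j,k}S_{i,l}+Q_{j,l}S_{i,k}+Q_{k,l}S_{i,j}\big),$$ and the matrix unfolding $F^s\in\mathbb R^{n^2\times n^2}$ by $F^s_{n(i-1)+k,\,n(j-1)+l}=\mathcal F^s_{i,j,k,l}$. Then $\mathcal F^s$ is super-symmetric, and for every $\hat w\in\mathbb R^n$ $$\mathcal F\odot(\hat w\otimes\hat w\otimes\hat w\otimes\hat w)=\mathcal F^s\odot(\hat w\otimes\hat w\otimes\hat w\otimes\hat w)=(\hat w\otimes\hat w)^TF^s(\hat w\otimes\hat w).$$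
   Context: For a fourth-order tensor $\mathcal T$, $\mathcal T\odot(\hat w\otimes\hat w\otimes\hat w\otimes\hat w)$ denotes the scalar polynomial $\sum_{i,j,k,l=1}^n\mathcal T_{i,j,k,l}\,\hat w_i\hat w_j\hat w_k\hat w_l$. A tensor is super-symmetric if its entries are invariant under every permutation of the indices. $\Phi_{\kappa[i,j]}$ is the $(i,j)$ entry of $\Phi_\kappa$; $\otimes$ is the Kronecker product. *)

theory Defs
  imports "Jordan_Normal_Form.Matrix" "HOL-Combinatorics.Permutations"
begin

text \<open>
  All indices are 0-based, so \<open>1, \<dots>, n\<close> becomes \<open>0, \<dots>, n - 1\<close>. A fourth-order tensor in
  $\mathbb{R}^{n \times n \times n \times n}$ is a function of four indices; only its values at
  indices below \<open>n\<close> are meaningful, and \<open>n\<close> is passed to the notions that depend on it.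
\<close>

type_synonym tensor4 = "nat \<Rightarrow> nat \<Rightarrow> nat \<Rightarrow> nat \<Rightarrow> real"

definition symmetric_mat :: "real mat \<Rightarrow> bool" where
  "symmetric_mat A \<longleftrightarrow> transpose_mat A = A"

definition positive_semidefinite :: "real mat \<Rightarrow> bool" where
  "positive_semidefinite A \<longleftrightarrow>
     symmetric_mat A \<and> (\<forall>x \<in> carrier_vec (dim_row A). 0 \<le> x \<bullet> (A *\<^sub>v x))"

definition super_symmetric :: "nat \<Rightarrow> tensor4 \<Rightarrow> bool" where
  "super_symmetric n T \<longleftrightarrow>
     (\<forall>(\<sigma> :: nat \<Rightarrow> nat) (ix :: nat \<Rightarrow> nat). \<sigma> permutes {..<4} \<longrightarrow> (\<forall>t<4. ix t < n) \<longrightarrow>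
        T (ix (\<sigma> 0)) (ix (\<sigma> 1)) (ix (\<sigma> 2)) (ix (\<sigma> 3)) = T (ix 0) (ix 1) (ix 2) (ix 3))"

text \<open>The scalar $\mathcal{T} \odot (w \otimes w \otimes w \otimes w)$, with \<open>n\<close> the dimension of \<open>w\<close>.\<close>

definition tensor_form :: "tensor4 \<Rightarrow> real vec \<Rightarrow> real" where
  "tensor_form T w =
     (let n = dim_vec w in
      \<Sum>i<n. \<Sum>j<n. \<Sum>k<n. \<Sum>l<n. T i j k l * w $ i * w $ j * w $ k * w $ l)"

definition kronecker_vec :: "real vec \<Rightarrow> real vec \<Rightarrow> real vec" (infixl "\<otimes>\<^sub>v" 70) where
  "u \<otimes>\<^sub>v v = vec (dim_vec u * dim_vec v) (\<lambda>p. u $ (p div dim_vec v) * v $ (p mod dim_vec v))"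

text \<open>
  The 1-based prescription that the entry at row $n(i-1)+k$ and column $n(j-1)+l$ is
  $\mathcal{T}_{i,j,k,l}$ reads, 0-based, row $ni+k$ and column $nj+l$
  (lemma \<open>unfolding_mat_index\<close>): the row carries the first and third tensor index.
\<close>

definition unfolding_mat :: "nat \<Rightarrow> tensor4 \<Rightarrow> real mat" where
  "unfolding_mat n T =
     mat (n^2) (n^2) (\<lambda>(p, q). T (p div n) (q div n) (p mod n) (q mod n))"

definition tensor_F :: "real mat \<Rightarrow> real mat \<Rightarrow> real mat \<Rightarrow> real \<Rightarrow> tensor4" where
  "tensor_F \<Phi> Q S \<rho> i j k l = \<Phi> $$ (i, j) * \<Phi> $$ (k, l) + \<rho> * Q $$ (i, j) * S $$ (k, l)"

definition tensor_Fs :: "real mat \<Rightarrow> real mat \<Rightarrow> real mat \<Rightarrow> real \<Rightarrow> tensor4" where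
  "tensor_Fs \<Phi> Q S \<rho> i j k l =
     1 / 3 * (\<Phi> $$ (i, j) * \<Phi> $$ (k, l) + \<Phi> $$ (i, k) * \<Phi> $$ (j, l) + \<Phi> $$ (i, l) * \<Phi> $$ (j, k))
     + 1 / 6 * \<rho> *
       (Q $$ (i, j) * S $$ (k, l) + Q $$ (i, k) * S $$ (j, l) + Q $$ (i, l) * S $$ (j, k)
        + Q $$ (j, k) * S $$ (i, l) + Q $$ (j, l) * S $$ (i, k) + Q $$ (k, l) * S $$ (i, j))"

lemma block_index_less:
  fixes i k n m :: nat
  assumes "i < m" "k < n"
  shows "n * i + k < m * n"
proof -
  have "n * i + k < n * Suc i" using assms by simp
  also have "\<dots> \<le> n * m" using assms by (intro mult_le_mono2) simp
  finally show ?thesis by (simp add: mult.commute)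
qed

lemma unfolding_mat_index:
  assumes "i < n" "j < n" "k < n" "l < n"
  shows "unfolding_mat n T $$ (n * i + k, n * j + l) = T i j k l"
  using assms block_index_less[of i n k n] block_index_less[of j n l n]
  by (simp add: unfolding_mat_def power2_eq_square)

lemma kronecker_vec_index:
  assumes "i < dim_vec u" "k < dim_vec v"
  shows "(u \<otimes>\<^sub>v v) $ (dim_vec v * i + k) = u $ i * v $ k"
proof -
  have "(dim_vec v * i + k) div dim_vec v = i"
    using assms(2) by (metis add.right_neutral div_less div_mult_self4 less_nat_zero_code add.commute)
  then show ?thesis
    using assms block_index_less[OF assms] by (simp add: kronecker_vec_def)
qed

end

theory Submission
  imports Defs
begin

text \<open>
  The form of a tensor is invariant under permuting its four indices, because the products of the
  components of \<open>w\<close> commute. \<open>tensor_Fs\<close> is a weighted average of index permutations of the two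
  summands of \<open>tensor_F\<close>, with weights that add up to one for each summand, so both tensors have
  the same form.
\<close>

lemma symmetric_mat_index:
  assumes "A \<in> carrier_mat n n" "symmetric_mat A" "i < n" "j < n"
  shows "A $$ (j, i) = A $$ (i, j)"
  using assms by (metis carrier_matD index_transpose_mat(1) symmetric_mat_def)

text \<open>Adjacent transpositions generate all permutations of four positions, so three identities
  suffice. The proof enumerates the values of \<sigma> at 0, 1, 2, 3; injectivity discards every
  combination except the 24 permutations.\<close>

lemma super_symmetricI:
  assumes swap01: "\<And>i j k l. i < n \<Longrightarrow> j < n \<Longrightarrow> k < n \<Longrightarrow> l < n \<Longrightarrow> T j i k l = T i j k l"
    and swap12: "\<And>i j k l. i < n \<Longrightarrow> j < n \<Longrightarrow> k < n \<Longrightarrow> l < n \<Longrightarrow> T i k j l = T i j k l"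
    and swap23: "\<And>i j k l. i < n \<Longrightarrow> j < n \<Longrightarrow> k < n \<Longrightarrow> l < n \<Longrightarrow> T i j l k = T i j k l"
  shows "super_symmetric n T"
  unfolding super_symmetric_def
proof (intro allI impI)
  fix \<sigma> ix :: "nat \<Rightarrow> nat"
  assume perm: "\<sigma> permutes {..<4}" and bound: "\<forall>t<4. ix t < n"
  have ix: "ix 0 < n" "ix 1 < n" "ix 2 < n" "ix 3 < n"
    using bound by auto
  have "\<sigma> t \<in> {0, 1, 2, 3}" if "t < 4" for t
    using permutes_in_image[OF perm, of t] that by auto
  then have range: "\<sigma> 0 \<in> {0, 1, 2, 3}" "\<sigma> 1 \<in> {0, 1, 2, 3}" "\<sigma> 2 \<in> {0, 1, 2, 3}" "\<sigma> 3 \<in> {0, 1, 2, 3}"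
    by simp_all
  have inj: "\<sigma> s = \<sigma> t \<longleftrightarrow> s = t" for s t
    using permutes_inj[OF perm] by (simp add: inj_eq)
  have distinct: "\<sigma> 0 \<noteq> \<sigma> 1" "\<sigma> 0 \<noteq> \<sigma> 2" "\<sigma> 0 \<noteq> \<sigma> 3" "\<sigma> 1 \<noteq> \<sigma> 2" "\<sigma> 1 \<noteq> \<sigma> 3" "\<sigma> 2 \<noteq> \<sigma> 3"
    by (simp_all add: inj)
  (* The transposition rules are permutative, so ordered rewriting sorts the four arguments. *)
  show "T (ix (\<sigma> 0)) (ix (\<sigma> 1)) (ix (\<sigma> 2)) (ix (\<sigma> 3)) = T (ix 0) (ix 1) (ix 2) (ix 3)"
    by (insert range distinct, elim insertE emptyE; simp add: swap01 swap12 swap23 ix[unfolded One_nat_def])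
qed

lemma tensor_form_add:
  "tensor_form (\<lambda>i j k l. T i j k l + U i j k l) w = tensor_form T w + tensor_form U w"
  by (simp add: tensor_form_def Let_def distrib_right sum.distrib)

lemma tensor_form_scale:
  "tensor_form (\<lambda>i j k l. c * T i j k l) w = c * tensor_form T w"
  by (simp add: tensor_form_def Let_def sum_distrib_left mult.assoc)

lemma tensor_form_swap01: "tensor_form (\<lambda>i j k l. T j i k l) w = tensor_form T w"
  unfolding tensor_form_def Let_def
  by (subst sum.swap) (simp add: mult_ac)

lemma tensor_form_swap12: "tensor_form (\<lambda>i j k l. T i k j l) w = tensor_form T w"
  unfolding tensor_form_def Let_def
  \<comment> \<open>The congruence step first passes under the sum over \<open>i\<close>, so that
    the exchange hits the sums over \<open>j\<close> and \<open>k\<close>.\<close>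
  by (rule sum.cong[OF refl], subst sum.swap) (simp add: mult_ac)

lemma tensor_form_swap23: "tensor_form (\<lambda>i j k l. T i j l k) w = tensor_form T w"
  unfolding tensor_form_def Let_def
  by (rule sum.cong[OF refl], rule sum.cong[OF refl], subst sum.swap) (simp add: mult_ac)

text \<open>These are the arrangements in \<open>tensor_Fs\<close> other than \<open>i j k l\<close>
  and \<open>i k j l\<close>; each is reached by composing adjacent swaps.\<close>

lemma tensor_form_pairings:
  shows "tensor_form (\<lambda>i j k l. T i l j k) w = tensor_form T w"
    and "tensor_form (\<lambda>i j k l. T j k i l) w = tensor_form T w"
    and "tensor_form (\<lambda>i j k l. T j l i k) w = tensor_form T w"
    and "tensor_form (\<lambda>i j k l. T k l i j) w = tensor_form T w"
proof -
  show iljk: "tensor_form (\<lambda>i j k l. T i l j k) w = tensor_form T w" for T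
    using tensor_form_swap23[of "\<lambda>i j k l. T i k j l"] tensor_form_swap12[of T] by simp
  show jkil: "tensor_form (\<lambda>i j k l. T j k i l) w = tensor_form T w" for T
    using tensor_form_swap01[of "\<lambda>i j k l. T i k j l"] tensor_form_swap12[of T] by simp
  show jlik: "tensor_form (\<lambda>i j k l. T j l i k) w = tensor_form T w" for T
    using tensor_form_swap23[of "\<lambda>i j k l. T j k i l"] jkil[of T] by simp
  show "tensor_form (\<lambda>i j k l. T k l i j) w = tensor_form T w"
    using tensor_form_swap12[of "\<lambda>i j k l. T j l i k"] jlik[of T] by simp
qed

lemma tensor_form_tensor_Fs:
  "tensor_form (tensor_Fs \<Phi> Q S \<rho>) w = tensor_form (tensor_F \<Phi> Q S \<rho>) w"
proof -
  define A where "A i j k l = \<Phi> $$ (i, j) * \<Phi> $$ (k, l)" for i j k l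
  define B where "B i j k l = Q $$ (i, j) * S $$ (k, l)" for i j k l
  have Fs: "tensor_Fs \<Phi> Q S \<rho> = (\<lambda>i j k l. 1 / 3 * (A i j k l + A i k j l + A i l j k)
      + 1 / 6 * \<rho> * (B i j k l + B i k j l + B i l j k + B j k i l + B j l i k + B k l i j))"
    by (intro ext) (simp add: tensor_Fs_def A_def B_def)
  have F: "tensor_F \<Phi> Q S \<rho> = (\<lambda>i j k l. A i j k l + \<rho> * B i j k l)"
    by (intro ext) (simp add: tensor_F_def A_def B_def)
  show ?thesis
    \<comment> \<open>The swap rules are instantiated because with a schematic tensor their
      left-hand sides would match any form at all.\<close>
    unfolding Fs F tensor_form_add tensor_form_scale tensor_form_swap12[of A] tensor_form_swap12[of B]
      tensor_form_pairings[of A] tensor_form_pairings[of B]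
    by simp
qed

text \<open>An adjacent transposition permutes the products in each bracket, up to reversing the two
  indices of an entry that contains both swapped ones. Symmetry of the matrices at that one index
  pair repairs this.\<close>

lemma super_symmetric_tensor_Fs:
  assumes "\<Phi> \<in> carrier_mat n n" "Q \<in> carrier_mat n n" "S \<in> carrier_mat n n"
    and "symmetric_mat \<Phi>" "symmetric_mat Q" "symmetric_mat S"
  shows "super_symmetric n (tensor_Fs \<Phi> Q S \<rho>)"
proof (rule super_symmetricI)
  fix i j k l assume "i < n" "j < n" "k < n" "l < n"
  note sym = symmetric_mat_index[OF assms(1,4)] symmetric_mat_index[OF assms(2,5)]
    symmetric_mat_index[OF assms(3,6)]
  show "tensor_Fs \<Phi> Q S \<rho> j i k l = tensor_Fs \<Phi> Q S \<rho> i j k l"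
    using sym[OF \<open>i < n\<close> \<open>j < n\<close>] by (simp add: tensor_Fs_def algebra_simps)
  show "tensor_Fs \<Phi> Q S \<rho> i k j l = tensor_Fs \<Phi> Q S \<rho> i j k l"
    using sym[OF \<open>j < n\<close> \<open>k < n\<close>] by (simp add: tensor_Fs_def algebra_simps)
  show "tensor_Fs \<Phi> Q S \<rho> i j l k = tensor_Fs \<Phi> Q S \<rho> i j k l"
    using sym[OF \<open>k < n\<close> \<open>l < n\<close>] by (simp add: tensor_Fs_def algebra_simps)
qed

text \<open>Division with remainder cuts the range into \<open>m\<close> consecutive blocks of
  length \<open>n\<close>: the quotient is the block, the remainder the place in it. For
  \<open>n = 0\<close> both sides are empty sums.\<close>

lemma sum_div_mod:
  fixes f :: "nat \<Rightarrow> nat \<Rightarrow> 'a :: comm_monoid_add"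
  shows "(\<Sum>p<m * n. f (p div n) (p mod n)) = (\<Sum>i<m. \<Sum>k<n. f i k)"
proof -
  have "(\<Sum>p<m * n. f (p div n) (p mod n)) =
      (\<Sum>i<m. \<Sum>p = i * n..<i * n + n. f (p div n) (p mod n))"
    by (rule sum.nat_group[symmetric])
  also have "\<dots> = (\<Sum>i<m. \<Sum>k<n. f i k)"
  proof (rule sum.cong[OF refl])
    fix i
    show "(\<Sum>p = i * n..<i * n + n. f (p div n) (p mod n)) = (\<Sum>k<n. f i k)"
      \<comment> \<open>Shifting the block to start at 0 turns \<open>p\<close> into
        \<open>k + i * n\<close> with \<open>k < n\<close>, whose quotient is \<open>i\<close> and
        remainder \<open>k\<close>.\<close>
      using sum.shift_bounds_nat_ivl[of "\<lambda>p. f (p div n) (p mod n)" 0 "i * n" n]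
      by (simp add: lessThan_atLeast0 add.commute)
  qed
  finally show ?thesis .
qed

lemma kronecker_unfolding_form:
  "(w \<otimes>\<^sub>v w) \<bullet> (unfolding_mat (dim_vec w) T *\<^sub>v (w \<otimes>\<^sub>v w)) = tensor_form T w"
proof -
  define n where "n = dim_vec w"
  have "(w \<otimes>\<^sub>v w) \<bullet> (unfolding_mat n T *\<^sub>v (w \<otimes>\<^sub>v w)) =
      (\<Sum>p<n * n. w $ (p div n) * w $ (p mod n) *
        (\<Sum>q<n * n. T (p div n) (q div n) (p mod n) (q mod n) * (w $ (q div n) * w $ (q mod n))))"
    by (simp add: unfolding_mat_def kronecker_vec_def scalar_prod_def power2_eq_square
        lessThan_atLeast0 flip: n_def)
  also have "\<dots> = (\<Sum>i<n. \<Sum>k<n. w $ i * w $ k * (\<Sum>j<n. \<Sum>l<n. T i j k l * (w $ j * w $ l)))"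
    \<comment> \<open>The column sum is split first; the placeholders are the row's quotient and
      remainder, fixed there. The row sum follows.\<close>
    unfolding sum_div_mod[of "\<lambda>j l. T _ j _ l * (w $ j * w $ l)"]
    by (rule sum_div_mod)
  also have "\<dots> = (\<Sum>i<n. \<Sum>k<n. \<Sum>j<n. \<Sum>l<n. T i j k l * w $ i * w $ j * w $ k * w $ l)"
    by (simp add: sum_distrib_left mult_ac)
  also have "\<dots> = tensor_form T w"
    unfolding tensor_form_def Let_def n_def[symmetric]
    \<comment> \<open>Rows carry the first and third tensor index, so the sums over \<open>k\<close>
      and \<open>j\<close> must be exchanged under the sum over \<open>i\<close>.\<close>
    by (intro sum.cong refl sum.swap)
  finally show ?thesis by (simp add: n_def)
qed

theorem propositionV4:
  fixes n m :: nat and \<Phi> Q S V :: "real mat" and \<rho> :: real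
  assumes "\<Phi> \<in> carrier_mat n n" and "Q \<in> carrier_mat n n" and "S \<in> carrier_mat n n"
    and "symmetric_mat \<Phi>" and "symmetric_mat Q" and "symmetric_mat S"
    and "\<rho> > 0"
    and "positive_semidefinite \<Phi>" and "positive_semidefinite Q"
    and "V \<in> carrier_mat n m" and "S = V * transpose_mat V"
  shows "super_symmetric n (tensor_Fs \<Phi> Q S \<rho>) \<and>
    (\<forall>w \<in> carrier_vec n.
       tensor_form (tensor_F \<Phi> Q S \<rho>) w = tensor_form (tensor_Fs \<Phi> Q S \<rho>) w \<and>
       tensor_form (tensor_Fs \<Phi> Q S \<rho>) w =
         (w \<otimes>\<^sub>v w) \<bullet> (unfolding_mat n (tensor_Fs \<Phi> Q S \<rho>) *\<^sub>v (w \<otimes>\<^sub>v w)))"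
proof (intro conjI ballI)
  show "super_symmetric n (tensor_Fs \<Phi> Q S \<rho>)"
    by (rule super_symmetric_tensor_Fs[OF assms(1-6)])
  fix w :: "real vec" assume "w \<in> carrier_vec n"
  then have n: "dim_vec w = n" by simp
  show "tensor_form (tensor_F \<Phi> Q S \<rho>) w = tensor_form (tensor_Fs \<Phi> Q S \<rho>) w"
    by (rule tensor_form_tensor_Fs[symmetric])
  show "tensor_form (tensor_Fs \<Phi> Q S \<rho>) w =
      (w \<otimes>\<^sub>v w) \<bullet> (unfolding_mat n (tensor_Fs \<Phi> Q S \<rho>) *\<^sub>v (w \<otimes>\<^sub>v w))"
    by (rule kronecker_unfolding_form[symmetric, where w = w, unfolded n])
qed

end
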